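(* Let $q = 2^n$ with $n \geq 1$, let $a, b \in \mathbb{F}_q$ with $a \neq 0$, and let $\theta : \mathbf{P}^1(\mathbb{F}_q) \to \mathbf{P}^1(\mathbb{F}_q)$ be given by $\theta(x) = a x^4 + b$ for $x \in \mathbb{F}_q$ and $\theta(\infty) = \infty$. Let $\alpha_1, \alpha_2 \in \mathbb{F}_q$ be such that $\alpha_1^2 = a^{-1}$ and $\alpha_2^2 = \alpha_1^2 b$, and let $E$ be the elliptic curve $y^2 + \alpha_1 y = x^3 + \alpha_2 x$ over $\mathbb{F}_q$. Fix positive integers $n_1, n_2$ and a group isomorphism $E(\mathbb{F}_{q^2}) \cong A := \mathbb{Z}/n_1\mathbb{Z} \times \mathbb{Z}/n_2\mathbb{Z}$. Let $x_0 \in \mathbb{F}_q$, let $P \in E(\mathbb{F}_{q^2})$ be a point whose $x$-coordinate is $x_0$, and write $P = ([a_1],[a_2])$ under the isomorphism, with $a_1, a_2 \in \mathbb{Z}$. For $i \in \{1,2\}$ put $d_i := \gcd(a_i, n_i)$ and $m_i := \min\{k \in \mathbb{N}^* : 2^k a_i \approx a_i \bmod n_i\}$. Put $m := \min\{k \in \mathbb{N}^* : 2^k P \approx P\}$ and $l := \operatorname{lcm}(m_1, m_2)$. Then: (1) for $i \in \{1,2\}$, $m_i$ is the smallest positive integer $k$ such that $2^k \approx 1 \bmod \frac{n_i}{d_i}$; (2) the length of the orbit of $x_0$ under $\theta$ (i.e. the smallest $j \in \mathbb{N}^*$ with $\theta^j(x_0) = x_0$) equals $m$; moreover $m = l$ if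 $2^l P \approx P$, and $m = 2l$ otherwise.
   Context: $\mathbb{N}$ denotes the non-negative integers and $\mathbb{N}^* = \mathbb{N}\setminus\{0\}$. $\mathbf{P}^1(\mathbb{F}_q) = \mathbb{F}_q \cup \{\infty\}$. For integers $x, y, N$, the notation $x \approx y \bmod N$ means $x \equiv y \bmod N$ or $x \equiv -y \bmod N$. For points $Q, R$ of an elliptic curve, $Q \approx R$ means $Q = R$ or $Q = -R$. $\theta^j$ denotes the $j$-fold composition of $\theta$. The points $P$ and $-P$ are the only points of $E$ with $x$-coordinate $x_0$. *)

theory Defs
  imports "HOL-Algebra.Elementary_Groups" "HOL-Number_Theory.Cong" "HOL-Library.Cardinality"
begin

datatype 'a proj_line = Fin 'a | Infty

text \<open>Coefficients of the Weierstrass equation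
  \<open>y\<^sup>2 + a\<^sub>1xy + a\<^sub>3y = x\<^sup>3 + a\<^sub>2x\<^sup>2 + a\<^sub>4x + a\<^sub>6\<close>.\<close>

record 'a weierstrass =
  wa1 :: 'a
  wa2 :: 'a
  wa3 :: 'a
  wa4 :: 'a
  wa6 :: 'a

datatype 'a point = Origin | Affine 'a 'a

definition on_curve :: "'a::field weierstrass \<Rightarrow> 'a \<Rightarrow> 'a \<Rightarrow> bool" where
  "on_curve W x y \<longleftrightarrow>
     y^2 + wa1 W * x * y + wa3 W * y = x^3 + wa2 W * x^2 + wa4 W * x + wa6 W"

definition curve_points :: "'a::field weierstrass \<Rightarrow> 'a point set" where
  "curve_points W = insert Origin {Affine x y | x y. on_curve W x y}"

text \<open>The chord-tangent law for a general Weierstrass equation in any characteristic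
  (Silverman, The Arithmetic of Elliptic Curves, III.2.3).  The first test in the affine case
  says that the second point is the negative of the first; \<open>l\<close> is the slope of the chord or
  tangent, and the last line reflects the third intersection point with the curve.\<close>

fun point_add :: "'a::field weierstrass \<Rightarrow> 'a point \<Rightarrow> 'a point \<Rightarrow> 'a point" where
  "point_add W Origin Q = Q"
| "point_add W (Affine x1 y1) Origin = Affine x1 y1"
| "point_add W (Affine x1 y1) (Affine x2 y2) =
     (if x1 = x2 \<and> y1 + y2 + wa1 W * x2 + wa3 W = 0 then Origin
      else
        let l = (if x1 = x2
                 then (3 * x1^2 + 2 * wa2 W * x1 + wa4 W - wa1 W * y1)
                        / (2 * y1 + wa1 W * x1 + wa3 W)
                 else (y2 - y1) / (x2 - x1));
            x3 = l^2 + wa1 W * l - wa2 W - x1 - x2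
        in Affine x3 (- (y1 + l * (x3 - x1)) - wa1 W * x3 - wa3 W))"

definition curve_group :: "'a::field weierstrass \<Rightarrow> 'a point monoid" where
  "curve_group W = \<lparr>carrier = curve_points W, monoid.mult = point_add W, one = Origin\<rparr>"

definition approx_mod :: "int \<Rightarrow> int \<Rightarrow> int \<Rightarrow> bool" where
  "approx_mod x y N \<longleftrightarrow> [x = y] (mod N) \<or> [x = - y] (mod N)"

definition approx_in :: "('g, 'm) monoid_scheme \<Rightarrow> 'g \<Rightarrow> 'g \<Rightarrow> bool" where
  "approx_in G Q R \<longleftrightarrow> Q = R \<or> Q = inv\<^bsub>G\<^esub> R"

definition smallest_pos :: "(nat \<Rightarrow> bool) \<Rightarrow> nat \<Rightarrow> bool" where
  "smallest_pos S k \<longleftrightarrow> 0 < k \<and> S k \<and> (\<forall>j. 0 < j \<and> S j \<longrightarrow> k \<le> j)"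

end

theory Submission
  imports Defs "HOL-Number_Theory.Residues"
begin

text \<open>In characteristic 2 the tangent slope at a point of \<open>E\<close> with abscissa \<open>x\<close> is
  \<open>(x\<^sup>2 + \<alpha>\<^sub>2) / \<alpha>\<^sub>1\<close>, so doubling acts on abscissae as
  \<open>x \<mapsto> (x\<^sup>4 + \<alpha>\<^sub>2\<^sup>2) / \<alpha>\<^sub>1\<^sup>2 = a x\<^sup>4 + b = \<theta> x\<close>.  Two affine points agree up to sign iff their
  abscissae agree, hence \<open>\<theta>\<close> returns to \<open>x\<^sub>0\<close> exactly when \<open>2\<^sup>k P \<approx> P\<close>.  Moreover doubling never
  produces the origin, so \<open>n\<^sub>1\<close> and \<open>n\<^sub>2\<close> are odd and the exponents \<open>k\<close> with
  \<open>2\<^sup>k \<approx> 1 mod n\<^sub>i/d\<^sub>i\<close> are the multiples of \<open>m\<^sub>i\<close>; at \<open>l\<close> the two signs may disagree,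
  but both become \<open>+1\<close> at \<open>2l\<close>.\<close>

section \<open>Congruences up to sign\<close>

text \<open>Dividing \<open>a\<close> and \<open>N\<close> by their gcd leaves coprime numbers, so
  the cofactor of \<open>a\<close> can be cancelled modulo the cofactor of \<open>N\<close>. The
  cases \<open>e = 1\<close> and \<open>e = -1\<close> together handle congruence up to
  sign.\<close>

lemma cong_mult_self_iff:
  fixes a c e N :: int
  assumes "N > 0"
  shows "[c * a = e * a] (mod N) \<longleftrightarrow> [c = e] (mod (N div gcd a N))"
proof -
  define g where "g = gcd a N"
  have g: "g > 0"
    using assms by (simp add: g_def)
  define a' N' where "a' = a div g" and "N' = N div g"
  have a: "a = a' * g" and N: "N = N' * g"
    by (auto simp: a'_def N'_def g_def)
  have cop: "coprime a' N'"
    unfolding a'_def N'_def g_def using assms by (intro div_gcd_coprime) auto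
  have "[c * a = e * a] (mod N) \<longleftrightarrow> N' * g dvd ((c - e) * a') * g"
    unfolding cong_iff_dvd_diff by (simp add: a N algebra_simps)
  also have "\<dots> \<longleftrightarrow> N' dvd (c - e) * a'"
    using g by simp
  also have "\<dots> \<longleftrightarrow> N' dvd c - e"
    using cop by (simp add: coprime_dvd_mult_left_iff coprime_commute)
  finally show ?thesis
    by (simp add: cong_iff_dvd_diff N'_def g_def)
qed

lemma approx_mod_mult_self_iff:
  assumes "N > 0"
  shows "approx_mod (c * a) a N \<longleftrightarrow> approx_mod c 1 (N div gcd a N)"
  using cong_mult_self_iff[OF assms, of c a 1] cong_mult_self_iff[OF assms, of c a "-1"]
  by (simp add: approx_mod_def)

text \<open>Modulo \<open>N\<close> the factor \<open>e\<close> is a sign, so removing it can only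
  change the sign of \<open>c * e\<close>.\<close>

lemma approx_mod_mult_cancel:
  assumes "approx_mod (c * e) 1 N" and "approx_mod e 1 N"
  shows "approx_mod c 1 N"
proof -
  have cancel: "[c * u = v] (mod N)" if "[e = u] (mod N)" "[c * e = v] (mod N)" for u v
    using cong_trans[OF cong_sym[OF cong_scalar_left[OF that(1)]] that(2)] .
  have "[- c = 1] (mod N) \<longleftrightarrow> [c = - 1] (mod N)"
    using cong_minus_minus_iff[of c "-1" N] by simp
  with cancel[of 1 1] cancel[of 1 "-1"] cancel[of "-1" 1] cancel[of "-1" "-1"] assms
  show ?thesis
    by (auto simp: approx_mod_def cong_minus_minus_iff)
qed

lemma approx_mod_power:
  assumes "approx_mod c 1 N"
  shows "approx_mod (c ^ k) 1 N"
proof (induction k)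
  case 0
  show ?case by (simp add: approx_mod_def)
next
  case (Suc k)
  have mult: "[c * c ^ k = u * v] (mod N)" if "[c = u] (mod N)" "[c ^ k = v] (mod N)" for u v
    using that by (rule cong_mult)
  from mult[of 1 1] mult[of 1 "-1"] mult[of "-1" 1] mult[of "-1" "-1"] assms Suc show ?case
    by (auto simp: approx_mod_def)
qed

lemma smallest_posI_Least:
  assumes "0 < k" and "S k"
  shows "smallest_pos S (LEAST k. 0 < k \<and> S k)"
  using LeastI[of "\<lambda>k. 0 < k \<and> S k" k] assms
  by (auto simp: smallest_pos_def intro: Least_le)

text \<open>Division with remainder: \<open>c ^ k\<close> is \<open>c ^ (k mod m)\<close> times a
  power of \<open>c ^ m\<close>. That power is a sign and cancels, so a nonzero remainder would
  contradict the minimality of \<open>m\<close>.\<close>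

lemma smallest_pos_approx_mod_dvd_iff:
  assumes "smallest_pos (\<lambda>k. approx_mod (c ^ k) 1 N) m"
  shows "approx_mod (c ^ k) 1 N \<longleftrightarrow> m dvd k"
proof
  assume k: "approx_mod (c ^ k) 1 N"
  have m: "0 < m" "approx_mod (c ^ m) 1 N"
    and min: "\<And>j. 0 < j \<Longrightarrow> approx_mod (c ^ j) 1 N \<Longrightarrow> m \<le> j"
    using assms by (auto simp: smallest_pos_def)
  have "c ^ k = c ^ (k mod m) * (c ^ m) ^ (k div m)"
    by (simp flip: power_mult power_add)
  with k have "approx_mod (c ^ (k mod m)) 1 N"
    using approx_mod_mult_cancel approx_mod_power m(2) by metis
  with min[of "k mod m"] m(1) show "m dvd k"
    by (meson mod_greater_zero_iff_not_dvd mod_less_divisor not_less)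
next
  assume "m dvd k"
  then obtain j where "k = m * j" ..
  with assms show "approx_mod (c ^ k) 1 N"
    by (simp add: power_mult approx_mod_power smallest_pos_def)
qed

lemma ex_power_approx_mod:
  assumes "coprime c (int N)" and "N > 0"
  shows "\<exists>k>0. approx_mod (c ^ k) 1 (int N)"
proof -
  \<comment> \<open>The natural representative of \<open>c\<close> modulo \<open>N\<close> makes
    \<open>euler_theorem\<close> applicable; the exponent \<open>totient N\<close> even yields the
    sign +1.\<close>
  define c' where "c' = nat (c mod int N)"
  have c': "[c = int c'] (mod int N)"
    using assms(2) by (simp add: c'_def cong_def)
  with assms(1) have "coprime c' N"
    using cong_imp_coprime coprime_int_iff by blast
  then have "[c' ^ totient N = 1] (mod N)"
    by (rule euler_theorem)
  then have "[int (c' ^ totient N) = int 1] (mod int N)"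
    by (simp only: cong_int_iff)
  then have "[int c' ^ totient N = 1] (mod int N)"
    by simp
  then have "[c ^ totient N = 1] (mod int N)"
    using c' cong_pow cong_trans by blast
  with assms(2) show ?thesis
    by (auto simp: approx_mod_def intro!: exI[of _ "totient N"])
qed

text \<open>This yields part (1). Since \<open>c\<close> stays coprime to the divisor
  \<open>N div gcd a N\<close> of \<open>N\<close>, some exponent exists, so the
  \<open>LEAST\<close> is attained.\<close>

lemma smallest_pos_approx_mod:
  fixes N :: nat
  assumes "N > 0" and "coprime c (int N)"
  shows "smallest_pos (\<lambda>k. approx_mod (c ^ k) 1 (int N div gcd a (int N)))
           (LEAST k. 0 < k \<and> approx_mod (c ^ k * a) a (int N))"
proof -
  define M where "M = N div nat (gcd a (int N))"
  have M: "int N div gcd a (int N) = int M"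
    by (simp add: M_def zdiv_int)
  have "int M dvd int N"
    unfolding M[symmetric] by (rule dvdI[of _ _ "gcd a (int N)"]) simp
  then have "coprime c (int M)" "M > 0"
    using assms coprime_divisors[of c c "int M" "int N"] by (auto intro!: Nat.gr0I)
  then obtain k where "k > 0" "approx_mod (c ^ k) 1 (int M)"
    using ex_power_approx_mod by blast
  moreover have "approx_mod (c ^ k * a) a (int N) \<longleftrightarrow> approx_mod (c ^ k) 1 (int M)" for k
    using assms(1) by (simp add: approx_mod_mult_self_iff M)
  ultimately show ?thesis
    unfolding M by (simp add: smallest_posI_Least)
qed

section \<open>The chord-tangent law\<close>

text \<open>The second premise is the divided difference of the cubic at the first two roots, which
  becomes the derivative when they coincide. Chord and tangent are thereby treated at once.\<close>

lemma cubic_third_root: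
  fixes c\<^sub>0 c\<^sub>1 c\<^sub>2 x\<^sub>1 x\<^sub>2 :: "'a::comm_ring_1"
  assumes "x\<^sub>1^3 + c\<^sub>2 * x\<^sub>1^2 + c\<^sub>1 * x\<^sub>1 + c\<^sub>0 = 0"
    and "x\<^sub>1^2 + x\<^sub>1 * x\<^sub>2 + x\<^sub>2^2 + c\<^sub>2 * (x\<^sub>1 + x\<^sub>2) + c\<^sub>1 = 0"
    and "x\<^sub>3 = - c\<^sub>2 - x\<^sub>1 - x\<^sub>2"
  shows "x\<^sub>3^3 + c\<^sub>2 * x\<^sub>3^2 + c\<^sub>1 * x\<^sub>3 + c\<^sub>0 = 0"
proof -
  \<comment> \<open>Newton's interpolation form: the last factor is the second divided difference,
    which vanishes by the choice of \<open>x\<^sub>3\<close> as minus \<open>c\<^sub>2\<close> minus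
    the other roots.\<close>
  have "x\<^sub>3^3 + c\<^sub>2 * x\<^sub>3^2 + c\<^sub>1 * x\<^sub>3 + c\<^sub>0 =
      (x\<^sub>1^3 + c\<^sub>2 * x\<^sub>1^2 + c\<^sub>1 * x\<^sub>1 + c\<^sub>0) + (x\<^sub>3 - x\<^sub>1) *
      ((x\<^sub>1^2 + x\<^sub>1 * x\<^sub>2 + x\<^sub>2^2 + c\<^sub>2 * (x\<^sub>1 + x\<^sub>2) + c\<^sub>1) +
       (x\<^sub>3 - x\<^sub>2) * (x\<^sub>3 - (- c\<^sub>2 - x\<^sub>1 - x\<^sub>2)))"
    by (simp add: algebra_simps power2_eq_square power3_eq_cube)
  also have "\<dots> = 0"
    unfolding assms(1,2) by (simp add: assms(3))
  finally show ?thesis .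
qed

lemma on_curve_neg_iff:
  "on_curve W x (- y - wa1 W * x - wa3 W) \<longleftrightarrow> on_curve W x y"
  unfolding on_curve_def by (simp add: algebra_simps power2_eq_square)

lemma on_curve_same_abscissa:
  assumes "on_curve W x y" and "on_curve W x y'"
  shows "y' = y \<or> y' = - y - wa1 W * x - wa3 W"
proof -
  have "(y' - y) * (y' + y + wa1 W * x + wa3 W) =
      (y'^2 + wa1 W * x * y' + wa3 W * y') - (y^2 + wa1 W * x * y + wa3 W * y)"
    by (simp add: algebra_simps power2_eq_square)
  with assms have "(y' - y) * (y' + y + wa1 W * x + wa3 W) = 0"
    by (simp add: on_curve_def)
  then have "y' - y = 0 \<or> y' + y + wa1 W * x + wa3 W = 0"
    by (simp only: mult_eq_0_iff)
  then show ?thesis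
    by (auto simp: eq_diff_eq eq_neg_iff_add_eq_0 add_ac)
qed

text \<open>Substituting the chord or tangent into the curve equation gives a monic cubic; its third
  root is the abscissa of the sum, and reflection preserves the curve.\<close>

lemma point_add_closed:
  assumes "P \<in> curve_points W" and "Q \<in> curve_points W"
  shows "point_add W P Q \<in> curve_points W"
proof (cases P)
  case Origin
  with assms show ?thesis by simp
next
  case P: (Affine x\<^sub>1 y\<^sub>1)
  show ?thesis
  proof (cases Q)
    case Origin
    with P assms show ?thesis by simp
  next
    case Q: (Affine x\<^sub>2 y\<^sub>2)
    have on1: "on_curve W x\<^sub>1 y\<^sub>1" and on2: "on_curve W x\<^sub>2 y\<^sub>2"
      using assms P Q by (auto simp: curve_points_def)
    show ?thesis
    proof (cases "x\<^sub>1 = x\<^sub>2 \<and> y\<^sub>1 + y\<^sub>2 + wa1 W * x\<^sub>2 + wa3 W = 0")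
      case True
      with P Q show ?thesis by (simp add: curve_points_def)
    next
      case False
      define l where "l = (if x\<^sub>1 = x\<^sub>2
                 then (3 * x\<^sub>1^2 + 2 * wa2 W * x\<^sub>1 + wa4 W - wa1 W * y\<^sub>1)
                        / (2 * y\<^sub>1 + wa1 W * x\<^sub>1 + wa3 W)
                 else (y\<^sub>2 - y\<^sub>1) / (x\<^sub>2 - x\<^sub>1))"
      define x\<^sub>3 where "x\<^sub>3 = l^2 + wa1 W * l - wa2 W - x\<^sub>1 - x\<^sub>2"
      define y\<^sub>3 where "y\<^sub>3 = y\<^sub>1 + l * (x\<^sub>3 - x\<^sub>1)"
      have add: "point_add W P Q = Affine x\<^sub>3 (- y\<^sub>3 - wa1 W * x\<^sub>3 - wa3 W)"
        using False unfolding P Q y\<^sub>3_def x\<^sub>3_def l_def by (simp add: Let_def)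
      \<comment> \<open>The coefficients of the cubic obtained by substituting the line
        \<open>y = l x + c\<close> into the equation of the curve.\<close>
      define c where "c = y\<^sub>1 - l * x\<^sub>1"
      define c\<^sub>2 where "c\<^sub>2 = wa2 W - l^2 - wa1 W * l"
      define c\<^sub>1 where "c\<^sub>1 = wa4 W - 2 * l * c - wa1 W * c - wa3 W * l"
      define c\<^sub>0 where "c\<^sub>0 = wa6 W - c^2 - wa3 W * c"
      have line: "on_curve W x (l * x + c) \<longleftrightarrow> x^3 + c\<^sub>2 * x^2 + c\<^sub>1 * x + c\<^sub>0 = 0" for x
      proof -
        have "x^3 + c\<^sub>2 * x^2 + c\<^sub>1 * x + c\<^sub>0 =
            (x^3 + wa2 W * x^2 + wa4 W * x + wa6 W) -
            ((l * x + c)^2 + wa1 W * x * (l * x + c) + wa3 W * (l * x + c))"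
          unfolding c\<^sub>2_def c\<^sub>1_def c\<^sub>0_def
          by (simp add: algebra_simps power2_eq_square mult_2)
        then show ?thesis
          by (metis on_curve_def right_minus_eq)
      qed
      have root1: "x\<^sub>1^3 + c\<^sub>2 * x\<^sub>1^2 + c\<^sub>1 * x\<^sub>1 + c\<^sub>0 = 0"
        using on1 by (simp add: c_def flip: line)
      have "x\<^sub>1^2 + x\<^sub>1 * x\<^sub>2 + x\<^sub>2^2 + c\<^sub>2 * (x\<^sub>1 + x\<^sub>2) + c\<^sub>1 = 0"
      proof (cases "x\<^sub>1 = x\<^sub>2")
        case True
        \<comment> \<open>Opposite points are excluded by \<open>False\<close>, so equal abscissae
          mean equal points; the same exclusion makes the denominator of the tangent slope
          nonzero.\<close>
        with False on1 on2 have "y\<^sub>2 = y\<^sub>1"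
          using on_curve_same_abscissa[of W x\<^sub>1 y\<^sub>1 y\<^sub>2] by (auto simp: algebra_simps)
        with False True have "2 * y\<^sub>1 + wa1 W * x\<^sub>1 + wa3 W \<noteq> 0"
          by (simp flip: mult_2)
        then have "l * (2 * y\<^sub>1 + wa1 W * x\<^sub>1 + wa3 W)
            = 3 * x\<^sub>1^2 + 2 * wa2 W * x\<^sub>1 + wa4 W - wa1 W * y\<^sub>1"
          using True by (simp add: l_def)
        moreover have "x\<^sub>1^2 + x\<^sub>1 * x\<^sub>1 + x\<^sub>1^2 + c\<^sub>2 * (x\<^sub>1 + x\<^sub>1) + c\<^sub>1 =
            (3 * x\<^sub>1^2 + 2 * wa2 W * x\<^sub>1 + wa4 W - wa1 W * y\<^sub>1) -
            l * (2 * y\<^sub>1 + wa1 W * x\<^sub>1 + wa3 W)"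
          unfolding c\<^sub>2_def c\<^sub>1_def c_def
          by (simp add: algebra_simps power2_eq_square)
        ultimately show ?thesis
          unfolding True[symmetric] by simp
      next
        case False
        then have "l * (x\<^sub>2 - x\<^sub>1) = y\<^sub>2 - y\<^sub>1"
          by (simp add: l_def)
        then have "l * x\<^sub>2 + c = y\<^sub>2"
          by (simp add: c_def algebra_simps)
        with on2 have "x\<^sub>2^3 + c\<^sub>2 * x\<^sub>2^2 + c\<^sub>1 * x\<^sub>2 + c\<^sub>0 = 0"
          by (simp flip: line)
        \<comment> \<open>Both abscissae are roots, so the difference of the two values is zero, and
          the nonzero factor \<open>x\<^sub>1 - x\<^sub>2\<close> can be cancelled.\<close>
        moreover have
          "(x\<^sub>1 - x\<^sub>2) * (x\<^sub>1^2 + x\<^sub>1 * x\<^sub>2 + x\<^sub>2^2 + c\<^sub>2 * (x\<^sub>1 + x\<^sub>2) + c\<^sub>1) =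
           (x\<^sub>1^3 + c\<^sub>2 * x\<^sub>1^2 + c\<^sub>1 * x\<^sub>1 + c\<^sub>0) - (x\<^sub>2^3 + c\<^sub>2 * x\<^sub>2^2 + c\<^sub>1 * x\<^sub>2 + c\<^sub>0)"
          by (simp add: algebra_simps power2_eq_square power3_eq_cube)
        ultimately show ?thesis
          using root1 False by simp
      qed
      with root1 have "x\<^sub>3^3 + c\<^sub>2 * x\<^sub>3^2 + c\<^sub>1 * x\<^sub>3 + c\<^sub>0 = 0"
        by (rule cubic_third_root) (simp add: x\<^sub>3_def c\<^sub>2_def)
      moreover have "y\<^sub>3 = l * x\<^sub>3 + c"
        by (simp add: y\<^sub>3_def c_def algebra_simps)
      ultimately have "on_curve W x\<^sub>3 y\<^sub>3"
        by (simp add: line)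
      then show ?thesis
        by (simp add: add curve_points_def on_curve_neg_iff)
    qed
  qed
qed

text \<open>Associativity and inverses are pulled back along the bijection. For the curve this
  leaves only closure and the neutral element to be read off the chord-tangent formulas.\<close>

lemma group_iso_closed:
  fixes G (structure)
  assumes iso: "\<phi> \<in> iso G H" and "group H"
    and closed: "\<And>x y. x \<in> carrier G \<Longrightarrow> y \<in> carrier G \<Longrightarrow> x \<otimes> y \<in> carrier G"
    and one: "\<one> \<in> carrier G" and l_one: "\<And>x. x \<in> carrier G \<Longrightarrow> \<one> \<otimes> x = x"
  shows "group G"
proof -
  interpret H: group H by fact
  have inj: "inj_on \<phi> (carrier G)" and img: "\<phi> ` carrier G = carrier H"
    using iso by (auto simp: iso_def bij_betw_def)
  have mult: "\<phi> (x \<otimes> y) = \<phi> x \<otimes>\<^bsub>H\<^esub> \<phi> y" if "x \<in> carrier G" "y \<in> carrier G" for x y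
    using iso that by (auto simp: iso_def hom_def)
  have mem: "\<phi> x \<in> carrier H" if "x \<in> carrier G" for x
    using img that by blast
  \<comment> \<open>The image of the neutral element is idempotent, and a group has only one
    idempotent.\<close>
  have phi_one: "\<phi> \<one> = \<one>\<^bsub>H\<^esub>"
    using mult[OF one one] mem[OF one] by (simp add: l_one one)
  show ?thesis
  proof (rule groupI)
    fix x y z
    assume xyz: "x \<in> carrier G" "y \<in> carrier G" "z \<in> carrier G"
    then have "\<phi> (x \<otimes> y \<otimes> z) = \<phi> (x \<otimes> (y \<otimes> z))"
      by (simp add: mult closed mem H.m_assoc)
    with inj xyz show "x \<otimes> y \<otimes> z = x \<otimes> (y \<otimes> z)"
      by (simp add: inj_on_eq_iff closed)
  next
    fix x
    assume x: "x \<in> carrier G"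
    then obtain y where y: "y \<in> carrier G" "\<phi> y = inv\<^bsub>H\<^esub> \<phi> x"
      using img mem by (metis H.inv_closed imageE)
    then have "\<phi> (y \<otimes> x) = \<phi> \<one>"
      by (simp add: mult x mem phi_one)
    with inj x y one have "y \<otimes> x = \<one>"
      by (simp add: inj_on_eq_iff closed)
    with y show "\<exists>y\<in>carrier G. y \<otimes> x = \<one>" by blast
  qed (use closed one l_one in auto)
qed

lemma curve_group_simps [simp]:
  "carrier (curve_group W) = curve_points W"
  "x \<otimes>\<^bsub>curve_group W\<^esub> y = point_add W x y"
  "\<one>\<^bsub>curve_group W\<^esub> = Origin"
  by (simp_all add: curve_group_def)

lemma Origin_in_curve_points [simp]: "Origin \<in> curve_points W"
  by (simp add: curve_points_def)

lemma Affine_in_curve_points_iff [simp]: "Affine x y \<in> curve_points W \<longleftrightarrow> on_curve W x y"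
  by (simp add: curve_points_def)

text \<open>The inverse of a point is its reflection, and the curve equation, quadratic in the
  ordinate, has no further root over the same abscissa.\<close>

lemma approx_in_curve_group_Affine_iff:
  assumes "group (curve_group W)" and "on_curve W x y" and "on_curve W x' y'"
  shows "approx_in (curve_group W) (Affine x y) (Affine x' y') \<longleftrightarrow> x = x'"
proof -
  interpret group "curve_group W" by fact
  have "inv\<^bsub>curve_group W\<^esub> (Affine x' y') = Affine x' (- y' - wa1 W * x' - wa3 W)"
    by (rule inv_equality) (use assms in \<open>simp_all add: on_curve_neg_iff\<close>)
  then show ?thesis
    using assms on_curve_same_abscissa[of W x y' y] by (auto simp: approx_in_def)
qed

section \<open>Doubling in characteristic two\<close>

lemma two_eq_zero_if_CARD_power_two:
  assumes "CARD('a::field) = 2 ^ n"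
  shows "(2 :: 'a) = 0"
proof -
  have "of_nat (CARD('a)) = (0 :: 'a)"
    using CHAR_dvd_CARD[where 'a='a] of_nat_eq_0_iff_char_dvd by blast
  then show ?thesis
    by (simp add: assms)
qed

text \<open>As \<open>y + y = 0\<close>, the test for opposite points reduces to
  \<open>wa3 W = 0\<close> and fails, so the tangent branch always applies. Only the abscissa
  matters for orbits; the ordinate stays existential.\<close>

lemma point_add_self_char_two:
  fixes W :: "'a::field weierstrass"
  assumes "(2 :: 'a) = 0" and "wa1 W = 0" and "wa2 W = 0" and "wa3 W \<noteq> 0"
  shows "\<exists>y'. point_add W (Affine x y) (Affine x y) =
           Affine ((x^4 + wa4 W ^ 2) / wa3 W ^ 2) y'"
proof -
  have dbl: "u + u = 0" for u :: 'a
    using assms(1) by (metis mult_2 mult_zero_left)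
  have "(3 :: 'a) = 2 + 1"
    by simp
  then have three: "(3 :: 'a) = 1"
    by (simp only: assms(1) add_0_left)
  have "((x^2 + wa4 W) / wa3 W)^2 - x - x = (x^4 + wa4 W ^ 2) / wa3 W ^ 2"
  proof -
    have "(x^2 + wa4 W)^2 = x^4 + wa4 W ^ 2 + 2 * (x^2 * wa4 W)"
      by (simp add: power2_sum mult.assoc flip: power_mult)
    then have "(x^2 + wa4 W)^2 = x^4 + wa4 W ^ 2"
      by (simp only: assms(1) mult_zero_left add_0_right)
    moreover have "u - x - x = u" for u
      using dbl[of x] by (simp add: diff_diff_eq)
    ultimately show ?thesis
      by (simp add: power_divide)
  qed
  then show ?thesis
    using assms by (simp add: Let_def dbl three)
qed

section \<open>Orbits of the quartic map\<close>

lemma (in group) pow_two_power_Suc: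
  assumes "x \<in> carrier G"
  shows "x [^] (2 ^ Suc k :: nat) = x [^] (2 ^ k :: nat) \<otimes> x [^] (2 ^ k :: nat)"
  using assms by (simp add: nat_pow_mult mult_2)

lemma hom_integer_mod_group_prod_pow:
  fixes k :: nat
  assumes "group G" and "\<phi> \<in> hom G (integer_mod_group n\<^sub>1 \<times>\<times> integer_mod_group n\<^sub>2)"
    and "P \<in> carrier G" and "\<phi> P = (a\<^sub>1 mod int n\<^sub>1, a\<^sub>2 mod int n\<^sub>2)"
  shows "\<phi> (P [^]\<^bsub>G\<^esub> k) = (int k * a\<^sub>1 mod int n\<^sub>1, int k * a\<^sub>2 mod int n\<^sub>2)"
proof (induction k)
  case 0
  have "\<phi> \<one>\<^bsub>G\<^esub> = \<one>\<^bsub>integer_mod_group n\<^sub>1 \<times>\<times> integer_mod_group n\<^sub>2\<^esub>"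
    using assms by (intro hom_one DirProd_group) auto
  then show ?case
    using assms(1) by (simp add: group.is_monoid monoid.nat_pow_0)
next
  case (Suc k)
  interpret group G by fact
  have "\<phi> (P [^]\<^bsub>G\<^esub> Suc k) =
      \<phi> (P [^]\<^bsub>G\<^esub> k) \<otimes>\<^bsub>integer_mod_group n\<^sub>1 \<times>\<times> integer_mod_group n\<^sub>2\<^esub> \<phi> P"
    using assms by (simp add: hom_mult)
  with Suc assms(4) show ?case
    by (simp add: mod_add_eq algebra_simps)
qed

text \<open>One sign must serve both coordinates. This is stronger than \<open>approx_mod\<close> in
  each coordinate separately, and the gap is the source of the alternative
  \<open>m = 2 * l\<close>.\<close>

lemma approx_in_pow_iff:
  fixes k :: nat
  assumes "group G" and iso: "\<phi> \<in> iso G (integer_mod_group n\<^sub>1 \<times>\<times> integer_mod_group n\<^sub>2)"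
    and P: "P \<in> carrier G" and \<phi>P: "\<phi> P = (a\<^sub>1 mod int n\<^sub>1, a\<^sub>2 mod int n\<^sub>2)"
  shows "approx_in G (P [^]\<^bsub>G\<^esub> k) P \<longleftrightarrow>
    [int k * a\<^sub>1 = a\<^sub>1] (mod int n\<^sub>1) \<and> [int k * a\<^sub>2 = a\<^sub>2] (mod int n\<^sub>2) \<or>
    [int k * a\<^sub>1 = - a\<^sub>1] (mod int n\<^sub>1) \<and> [int k * a\<^sub>2 = - a\<^sub>2] (mod int n\<^sub>2)"
proof -
  interpret group G by fact
  have hom: "\<phi> \<in> hom G (integer_mod_group n\<^sub>1 \<times>\<times> integer_mod_group n\<^sub>2)"
    and inj: "inj_on \<phi> (carrier G)"
    using iso by (auto simp: iso_def bij_betw_def)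
  have pow: "\<phi> (P [^]\<^bsub>G\<^esub> j) = (int j * a\<^sub>1 mod int n\<^sub>1, int j * a\<^sub>2 mod int n\<^sub>2)" for j :: nat
    by (rule hom_integer_mod_group_prod_pow) fact+
  have eq_iff: "P [^]\<^bsub>G\<^esub> i = P [^]\<^bsub>G\<^esub> j \<longleftrightarrow>
      [int i * a\<^sub>1 = int j * a\<^sub>1] (mod int n\<^sub>1) \<and> [int i * a\<^sub>2 = int j * a\<^sub>2] (mod int n\<^sub>2)" for i j :: nat
    using inj_on_eq_iff[OF inj, of "P [^]\<^bsub>G\<^esub> i" "P [^]\<^bsub>G\<^esub> j"] P by (simp add: pow cong_def)
  have "P [^]\<^bsub>G\<^esub> k = P \<longleftrightarrow> P [^]\<^bsub>G\<^esub> k = P [^]\<^bsub>G\<^esub> (1 :: nat)"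
    using P by simp
  \<comment> \<open>Being the inverse of \<open>P\<close> is rewritten as
    \<open>P [^] Suc k = \<one>\<close>, so that \<open>eq_iff\<close> for natural exponents covers
    this case as well.\<close>
  moreover have "P [^]\<^bsub>G\<^esub> k = inv\<^bsub>G\<^esub> P \<longleftrightarrow> P [^]\<^bsub>G\<^esub> Suc k = P [^]\<^bsub>G\<^esub> (0 :: nat)"
    using P by (metis inv_equality l_inv nat_pow_0 nat_pow_Suc nat_pow_closed)
  moreover have "[int (Suc k) * u = 0] (mod N) \<longleftrightarrow> [int k * u = - u] (mod N)" for u N
    by (simp add: cong_iff_dvd_diff algebra_simps)
  ultimately show ?thesis
    unfolding approx_in_def eq_iff by simp
qed

text \<open>For an even modulus, half of it in that coordinate and 0 in the other is a nonzero
  element whose double is zero.\<close>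

lemma (in group) odd_if_no_two_torsion:
  assumes iso: "\<phi> \<in> iso G (integer_mod_group n\<^sub>1 \<times>\<times> integer_mod_group n\<^sub>2)"
    and pos: "n\<^sub>1 > 0" "n\<^sub>2 > 0"
    and no_two_torsion: "\<And>x. x \<in> carrier G \<Longrightarrow> x \<otimes> x = \<one> \<Longrightarrow> x = \<one>"
  shows "odd n\<^sub>1" and "odd n\<^sub>2"
proof -
  let ?H = "integer_mod_group n\<^sub>1 \<times>\<times> integer_mod_group n\<^sub>2"
  have hom: "\<phi> \<in> hom G ?H" and inj: "inj_on \<phi> (carrier G)" and img: "\<phi> ` carrier G = carrier ?H"
    using iso by (auto simp: iso_def bij_betw_def)
  have one: "\<phi> \<one> = (0, 0)"
    using hom_one[OF hom is_group] by (simp add: DirProd_group)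
  have H: "u = (0, 0)" if u: "u \<in> carrier ?H" "u \<otimes>\<^bsub>?H\<^esub> u = (0, 0)" for u
  proof -
    obtain x where x: "x \<in> carrier G" "u = \<phi> x"
      using u(1) img by blast
    with u hom have "\<phi> (x \<otimes> x) = \<phi> \<one>"
      by (simp add: hom_mult one)
    with inj x have "x \<otimes> x = \<one>"
      by (simp add: inj_on_eq_iff)
    with x(1) have "x = \<one>"
      by (rule no_two_torsion)
    with x(2) one show ?thesis by simp
  qed
  show "odd n\<^sub>1"
  proof
    assume "even n\<^sub>1"
    then have "int n\<^sub>1 div 2 + int n\<^sub>1 div 2 = int n\<^sub>1" by presburger
    with H[of "(int n\<^sub>1 div 2, 0)"] pos \<open>even n\<^sub>1\<close> show False
      by (auto simp: carrier_integer_mod_group)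
  qed
  show "odd n\<^sub>2"
  proof
    assume "even n\<^sub>2"
    then have "int n\<^sub>2 div 2 + int n\<^sub>2 div 2 = int n\<^sub>2" by presburger
    with H[of "(0, int n\<^sub>2 div 2)"] pos \<open>even n\<^sub>2\<close> show False
      by (auto simp: carrier_integer_mod_group)
  qed
qed

theorem theorem3p1:
  fixes n n\<^sub>1 n\<^sub>2 m\<^sub>1 m\<^sub>2 m l :: nat
    and a b \<alpha>\<^sub>1 \<alpha>\<^sub>2 x\<^sub>0 :: "'f::field"
    and \<theta> :: "'f proj_line \<Rightarrow> 'f proj_line"
    and \<iota> :: "'f \<Rightarrow> 'k::field"
    and E :: "'k weierstrass"
    and G :: "'k point monoid"
    and \<phi> :: "'k point \<Rightarrow> int \<times> int"
    and y\<^sub>0 :: 'k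
    and P :: "'k point"
    and a\<^sub>1 a\<^sub>2 d\<^sub>1 d\<^sub>2 :: int
  assumes "n \<ge> 1"
    and "CARD('f) = 2 ^ n"
    and "CARD('k) = (2 ^ n) ^ 2"
    and "\<iota> 1 = 1"
    and "\<And>u v. \<iota> (u + v) = \<iota> u + \<iota> v"
    and "\<And>u v. \<iota> (u * v) = \<iota> u * \<iota> v"
    and "a \<noteq> 0"
    and "\<And>x. \<theta> (Fin x) = Fin (a * x ^ 4 + b)"
    and "\<theta> Infty = Infty"
    and "\<alpha>\<^sub>1 ^ 2 = inverse a"
    and "\<alpha>\<^sub>2 ^ 2 = \<alpha>\<^sub>1 ^ 2 * b"
    and "E = \<lparr>wa1 = 0, wa2 = 0, wa3 = \<iota> \<alpha>\<^sub>1, wa4 = \<iota> \<alpha>\<^sub>2, wa6 = 0\<rparr>"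
    and "G = curve_group E"
    and "n\<^sub>1 > 0"
    and "n\<^sub>2 > 0"
    and "\<phi> \<in> iso G (integer_mod_group n\<^sub>1 \<times>\<times> integer_mod_group n\<^sub>2)"
    and "P \<in> carrier G"
    and "P = Affine (\<iota> x\<^sub>0) y\<^sub>0"
    and "\<phi> P = (a\<^sub>1 mod int n\<^sub>1, a\<^sub>2 mod int n\<^sub>2)"
    and "d\<^sub>1 = gcd a\<^sub>1 (int n\<^sub>1)"
    and "d\<^sub>2 = gcd a\<^sub>2 (int n\<^sub>2)"
    and "m\<^sub>1 = (LEAST k. 0 < k \<and> approx_mod (2 ^ k * a\<^sub>1) a\<^sub>1 (int n\<^sub>1))"
    and "m\<^sub>2 = (LEAST k. 0 < k \<and> approx_mod (2 ^ k * a\<^sub>2) a\<^sub>2 (int n\<^sub>2))"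
    and "m = (LEAST k. 0 < k \<and> approx_in G (P [^]\<^bsub>G\<^esub> (2 ^ k :: nat)) P)"
    and "l = lcm m\<^sub>1 m\<^sub>2"
  shows "(smallest_pos (\<lambda>k. approx_mod (2 ^ k) 1 (int n\<^sub>1 div d\<^sub>1)) m\<^sub>1 \<and>
          smallest_pos (\<lambda>k. approx_mod (2 ^ k) 1 (int n\<^sub>2 div d\<^sub>2)) m\<^sub>2) \<and>
         (smallest_pos (\<lambda>j. (\<theta> ^^ j) (Fin x\<^sub>0) = Fin x\<^sub>0) m \<and>
          (if approx_in G (P [^]\<^bsub>G\<^esub> (2 ^ l :: nat)) P then m = l else m = 2 * l))"
proof -

  \<comment> \<open>The field embedding and the abscissa of a double\<close>
  note \<iota>_add = assms(5) and \<iota>_mult = assms(6)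
  have \<iota>_pow: "\<iota> (u ^ k) = \<iota> u ^ k" for u k
    by (induction k) (simp_all add: assms(4) \<iota>_mult)
  have \<iota>_nz: "\<iota> u \<noteq> 0" if "u \<noteq> 0" for u
    using \<iota>_mult[of u "inverse u"] that assms(4) by auto
  have \<iota>_inj: "u = v" if "\<iota> u = \<iota> v" for u v
    using \<iota>_nz[of "u - v"] \<iota>_add[of "u - v" v] that by auto
  have \<alpha>\<^sub>1: "\<alpha>\<^sub>1 \<noteq> 0"
    using assms(7,10) by auto
  have "CARD('k) = 2 ^ (n * 2)"
    using assms(3) by (simp add: power_mult)
  then have two: "(2 :: 'k) = 0"
    by (rule two_eq_zero_if_CARD_power_two)
  have E: "wa1 E = 0" "wa2 E = 0" "wa3 E = \<iota> \<alpha>\<^sub>1" "wa4 E = \<iota> \<alpha>\<^sub>2"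
    using assms(12) by simp_all
  have double: "\<exists>y'. point_add E (Affine x y) (Affine x y) =
      Affine ((x^4 + \<iota> \<alpha>\<^sub>2 ^ 2) / \<iota> \<alpha>\<^sub>1 ^ 2) y'" for x y
    using point_add_self_char_two[of E x y] two E \<alpha>\<^sub>1 \<iota>_nz by simp
  have \<iota>_\<theta>: "(\<iota> x ^ 4 + \<iota> \<alpha>\<^sub>2 ^ 2) / \<iota> \<alpha>\<^sub>1 ^ 2 = \<iota> (a * x ^ 4 + b)" for x
  proof -
    \<comment> \<open>The relations \<open>a * \<alpha>\<^sub>1 ^ 2 = 1\<close> and
      \<open>\<alpha>\<^sub>1 ^ 2 * b = \<alpha>\<^sub>2 ^ 2\<close> are used after clearing
      denominators in the base field.\<close>
    have "(a * x ^ 4 + b) * \<alpha>\<^sub>1 ^ 2 = x ^ 4 + \<alpha>\<^sub>2 ^ 2"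
      using assms(7) by (simp add: assms(10,11) field_simps)
    then have "\<iota> (a * x ^ 4 + b) * \<iota> \<alpha>\<^sub>1 ^ 2 = \<iota> x ^ 4 + \<iota> \<alpha>\<^sub>2 ^ 2"
      by (metis \<iota>_add \<iota>_mult \<iota>_pow)
    then show ?thesis
      using \<iota>_nz[OF \<alpha>\<^sub>1] by (simp add: field_simps)
  qed

  \<comment> \<open>The group of points and the exponents of each coordinate\<close>
  have grp: "group G"
    using assms(16) unfolding assms(13)
    by (rule group_iso_closed) (auto intro: DirProd_group point_add_closed)
  interpret G: group G by (rule grp)
  have no_two_torsion: "x = \<one>\<^bsub>G\<^esub>" if "x \<otimes>\<^bsub>G\<^esub> x = \<one>\<^bsub>G\<^esub>" for x
  proof (cases x)
    case (Affine u v)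
    with that double[of u v] show ?thesis
      unfolding assms(13) curve_group_simps by (metis point.distinct(1))
  qed (simp add: assms(13))
  \<comment> \<open>Oddness makes 2 coprime to both moduli, as
    \<open>smallest_pos_approx_mod\<close> requires.\<close>
  have odd: "odd n\<^sub>1" "odd n\<^sub>2"
    using G.odd_if_no_two_torsion[OF assms(16,14,15)] no_two_torsion by blast+
  have m\<^sub>1: "smallest_pos (\<lambda>k. approx_mod (2 ^ k) 1 (int n\<^sub>1 div d\<^sub>1)) m\<^sub>1"
    unfolding assms(20,22) using odd assms(14) by (intro smallest_pos_approx_mod) auto
  have m\<^sub>2: "smallest_pos (\<lambda>k. approx_mod (2 ^ k) 1 (int n\<^sub>2 div d\<^sub>2)) m\<^sub>2"
    unfolding assms(21,23) using odd assms(15) by (intro smallest_pos_approx_mod) auto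
  have dvd\<^sub>1: "approx_mod (2 ^ k * a\<^sub>1) a\<^sub>1 (int n\<^sub>1) \<longleftrightarrow> m\<^sub>1 dvd k" for k
    using smallest_pos_approx_mod_dvd_iff[OF m\<^sub>1] assms(14)
    by (simp add: approx_mod_mult_self_iff assms(20))
  have dvd\<^sub>2: "approx_mod (2 ^ k * a\<^sub>2) a\<^sub>2 (int n\<^sub>2) \<longleftrightarrow> m\<^sub>2 dvd k" for k
    using smallest_pos_approx_mod_dvd_iff[OF m\<^sub>2] assms(15)
    by (simp add: approx_mod_mult_self_iff assms(21))

  \<comment> \<open>Comparison of \<open>m\<close> with \<open>l\<close>\<close>
  let ?S = "\<lambda>k. approx_in G (P [^]\<^bsub>G\<^esub> (2 ^ k :: nat)) P"
  have S_iff: "?S k \<longleftrightarrow>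
    [2 ^ k * a\<^sub>1 = a\<^sub>1] (mod int n\<^sub>1) \<and> [2 ^ k * a\<^sub>2 = a\<^sub>2] (mod int n\<^sub>2) \<or>
    [2 ^ k * a\<^sub>1 = - a\<^sub>1] (mod int n\<^sub>1) \<and> [2 ^ k * a\<^sub>2 = - a\<^sub>2] (mod int n\<^sub>2)" for k
    using approx_in_pow_iff[OF grp assms(16,17,19), of "2 ^ k"] by simp
  have l_dvd: "l dvd k" if "?S k" for k
    using that dvd\<^sub>1[of k] dvd\<^sub>2[of k] unfolding S_iff assms(25) approx_mod_def by auto
  have l_pos: "l > 0"
    using m\<^sub>1 m\<^sub>2 by (simp add: assms(25) smallest_pos_def lcm_pos_nat)
  \<comment> \<open>The sign \<open>e\<close> occurring at \<open>l\<close> satisfies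
    \<open>e * e = 1\<close>, so it disappears at \<open>2 * l\<close>.\<close>
  have square: "[2 ^ (2 * l) * u = u] (mod N)" if "approx_mod (2 ^ l * u) u N" for u N :: int
  proof -
    have "[2 ^ l * u = 1 * u] (mod N) \<or> [2 ^ l * u = - 1 * u] (mod N)"
      using that by (simp add: approx_mod_def)
    moreover have "(1 :: int) * 1 = 1" "(- 1 :: int) * - 1 = 1"
      by simp_all
    ultimately obtain e :: int where e: "[2 ^ l * u = e * u] (mod N)" "e * e = 1"
      by blast
    have "[2 ^ l * (2 ^ l * u) = 2 ^ l * (e * u)] (mod N)"
      using e(1) by (rule cong_scalar_left)
    also have "2 ^ l * (e * u) = e * (2 ^ l * u)"
      by simp
    also have "[e * (2 ^ l * u) = e * (e * u)] (mod N)"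
      using e(1) by (rule cong_scalar_left)
    also have "e * (e * u) = u"
      using e(2) by (simp flip: mult.assoc)
    finally show ?thesis
      by (simp add: mult_2 power_add mult.assoc)
  qed
  \<comment> \<open>At \<open>2 * l\<close> both coordinates carry the sign +1, so the signs agree
    even if they differed at \<open>l\<close>.\<close>
  have S_2l: "?S (2 * l)"
    using square dvd\<^sub>1[of l] dvd\<^sub>2[of l] unfolding S_iff assms(25) by auto
  have m: "smallest_pos ?S m"
    unfolding assms(24) using S_2l l_pos by (intro smallest_posI_Least[of "2 * l"]) auto
  have m_cases: "if ?S l then m = l else m = 2 * l"
  proof -
    \<comment> \<open>A positive multiple of \<open>l\<close> that is at most \<open>2 * l\<close>
      is \<open>l\<close> or \<open>2 * l\<close>; whether \<open>?S l\<close> holds decides between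
      them.\<close>
    have "l dvd m" "m \<le> 2 * l" "m > 0" "?S m" and le: "?S l \<Longrightarrow> m \<le> l"
      using m l_dvd S_2l l_pos by (auto simp: smallest_pos_def)
    then obtain c where c: "m = l * c" "c > 0" by auto
    with \<open>m \<le> 2 * l\<close> l_pos have "c = 1 \<or> c = 2" by auto
    with c \<open>?S m\<close> le l_pos show ?thesis by auto
  qed

  \<comment> \<open>The orbit of \<open>x\<^sub>0\<close> followed through repeated doubling of
    \<open>P\<close>\<close>
  have orbit: "\<exists>x y. (\<theta> ^^ k) (Fin x\<^sub>0) = Fin x \<and> on_curve E (\<iota> x) y \<and>
      P [^]\<^bsub>G\<^esub> (2 ^ k :: nat) = Affine (\<iota> x) y" for k
  proof (induction k)
    case 0
    show ?case
      using assms(13,17,18) by auto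
  next
    case (Suc k)
    then obtain x y where x: "(\<theta> ^^ k) (Fin x\<^sub>0) = Fin x"
      and y: "P [^]\<^bsub>G\<^esub> (2 ^ k :: nat) = Affine (\<iota> x) y" by blast
    obtain y' where "point_add E (Affine (\<iota> x) y) (Affine (\<iota> x) y) =
        Affine (\<iota> (a * x ^ 4 + b)) y'"
      using double[of "\<iota> x" y] unfolding \<iota>_\<theta> by blast
    then have pow: "P [^]\<^bsub>G\<^esub> (2 ^ Suc k :: nat) = Affine (\<iota> (a * x ^ 4 + b)) y'"
      unfolding G.pow_two_power_Suc[OF assms(17)] y by (simp add: assms(13))
    \<comment> \<open>Powers of \<open>P\<close> stay in the carrier, which gives the curve equation
      for the doubled point without computing \<open>y'\<close>.\<close>
    then have "on_curve E (\<iota> (a * x ^ 4 + b)) y'"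
      using G.nat_pow_closed[OF assms(17), of "2 ^ Suc k"] by (simp add: assms(13))
    with pow x show ?case
      by (auto simp: assms(8))
  qed
  \<comment> \<open>Equality of abscissae over the large field descends to the base field by
    injectivity of \<open>\<iota>\<close>, so the return times of the orbit are exactly the
    exponents satisfying \<open>?S\<close>.\<close>
  have "(\<theta> ^^ k) (Fin x\<^sub>0) = Fin x\<^sub>0 \<longleftrightarrow> ?S k" for k
  proof -
    obtain x y where "(\<theta> ^^ k) (Fin x\<^sub>0) = Fin x" "on_curve E (\<iota> x) y"
      "P [^]\<^bsub>G\<^esub> (2 ^ k :: nat) = Affine (\<iota> x) y"
      using orbit by blast
    moreover have "on_curve E (\<iota> x\<^sub>0) y\<^sub>0"
      using assms(13,17,18) by simp
    ultimately show ?thesis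
      using approx_in_curve_group_Affine_iff[of E "\<iota> x" y "\<iota> x\<^sub>0" y\<^sub>0] grp \<iota>_inj
      unfolding assms(13,18) by auto
  qed
  with m m\<^sub>1 m\<^sub>2 m_cases show ?thesis by simp
qed

end
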